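(* Let $n\ge3$ and let $K_n$ be the complete graph on $n$ vertices. Let $Z_{K_n}(\mathfrak k)$ denote the tropical function computing torsion orders, i.e. for every family $\mathfrak k=\{\mathfrak k_v\}_{v\in V(K_n)}$ of non-negative integers and every odd prime $p$, the order of the $p$-torsion ($p$-primary torsion) subgroup of $H^1(K_n,p^{\mathfrak k})$ is $p^{Z_{K_n}(\mathfrak k)}$. Then $$Z_{K_n}(\mathfrak k)=(\sigma_1(\mathfrak k))^{n-3}\,\sigma_3(\mathfrak k),$$ where $\sigma_i$ is the $i$-th tropical elementary symmetric function in the vertices of $K_n$ and the product and power are tropical.
   Context: For a finite graph $\Gamma$ without loops or multiple edges and with a positive integer weight $k_v$ at each vertex, $C^*(\Gamma,\mathbf k)$ is the cochain complex with $C^0=\mathbf Z[V(\Gamma)]$, $C^1=\mathbf Z[E(\Gamma)]$, $d^0(v)=\sum_{w} k_w\, e(v,w)$ (sum over neighbours $w$ of $v$, $e(v,w)$ the edge joining them), and $H^*(\Gamma,\mathbf k)$ is its cohomology. $p^{\mathfrak k}$ denotes the weights $p^{\mathfrak k_v}$. Tropical operations are those of $\mathbf Z\cup\{\infty\}$: tropical sum is $\min$ and tropical product is $+$. The tropical elementary symmetric function is $\sigma_i=\sum_{X\subset V(K_n),\,|X|=i}\prod_{v\in X}v$ with tropical sum and product, so $\sigma_i(\mathfrak k)$ is the (ordinary) sum of the $i$ smallest of the numbers $\mathfrak k_v$ (counted with multiplicity). Thus the right-hand side equals, in ordinary notation, $(n-3)\min_v\mathfrak k_v$ plus the sum of the three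 smallest of the numbers $\mathfrak k_v$. *)

theory Defs
  imports "HOL-Algebra.Free_Abelian_Groups" "HOL-Computational_Algebra.Primes"
begin

text \<open>The tropical semiring on the integers with an added infinity. The ring operations are the
  tropical ones, so \<open>+\<close>, \<open>*\<close>, \<open>^\<close>, \<open>\<Sum>\<close> and \<open>\<Prod>\<close> at this type mean minimum, addition,
  multiplication by a natural number, finite minimum and finite sum; the constant \<open>0\<close> is infinity
  and \<open>1\<close> is the integer zero.\<close>

datatype tropical = Trop int | Trop_Inf

instantiation tropical :: comm_semiring_1
begin

definition "(0 :: tropical) = Trop_Inf"

definition "(1 :: tropical) = Trop 0"

fun plus_tropical :: "tropical \<Rightarrow> tropical \<Rightarrow> tropical" where
  "plus_tropical (Trop a) (Trop b) = Trop (min a b)"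
| "plus_tropical Trop_Inf y = y"
| "plus_tropical x Trop_Inf = x"

fun times_tropical :: "tropical \<Rightarrow> tropical \<Rightarrow> tropical" where
  "times_tropical (Trop a) (Trop b) = Trop (a + b)"
| "times_tropical Trop_Inf y = Trop_Inf"
| "times_tropical x Trop_Inf = Trop_Inf"

instance
proof
  fix a b c :: tropical
  show "a + b + c = a + (b + c)"
    by (cases a; cases b; cases c) (auto simp: min.assoc)
  show "a + b = b + a"
    by (cases a; cases b) (auto simp: min.commute)
  show "0 + a = a"
    by (simp add: zero_tropical_def)
  show "a * b * c = a * (b * c)"
    by (cases a; cases b; cases c) auto
  show "a * b = b * a"
    by (cases a; cases b) auto
  show "1 * a = a"
    by (cases a) (auto simp: one_tropical_def)
  show "(a + b) * c = a * c + b * c"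
    by (cases a; cases b; cases c) auto
  show "0 * a = 0" "a * 0 = 0"
    by (cases a; simp add: zero_tropical_def)+
  show "(0 :: tropical) \<noteq> 1"
    by (simp add: zero_tropical_def one_tropical_def)
qed

end

definition elem_sym :: "nat \<Rightarrow> 'a set \<Rightarrow> ('a \<Rightarrow> 'b::comm_semiring_1) \<Rightarrow> 'b" where
  "elem_sym i V x = (\<Sum>X | X \<subseteq> V \<and> card X = i. \<Prod>v\<in>X. x v)"

text \<open>A graph without loops or multiple edges is given by its vertex set \<open>V\<close> and its set \<open>E\<close> of
  edges, an edge being the two-element set of its end points.\<close>

definition simple_graph :: "'a set \<Rightarrow> 'a set set \<Rightarrow> bool" where
  "simple_graph V E \<longleftrightarrow> finite V \<and> (\<forall>e\<in>E. e \<subseteq> V \<and> card e = 2)"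

definition complete_edges :: "'a set \<Rightarrow> 'a set set" where
  "complete_edges V = {e. e \<subseteq> V \<and> card e = 2}"

definition coboundary0 :: "'a set \<Rightarrow> 'a set set \<Rightarrow> ('a \<Rightarrow> nat) \<Rightarrow> ('a \<Rightarrow>\<^sub>0 int) \<Rightarrow> ('a set \<Rightarrow>\<^sub>0 int)" where
  "coboundary0 V E k =
     frag_extend (\<lambda>v. \<Sum>w | w \<in> V \<and> {v, w} \<in> E. frag_cmul (int (k w)) (frag_of {v, w}))"

text \<open>The complex has no cochains in degree 2, so the first cohomology is the cokernel of
  \<open>coboundary0\<close>.\<close>

definition cohomology1 :: "'a set \<Rightarrow> 'a set set \<Rightarrow> ('a \<Rightarrow> nat) \<Rightarrow> ('a set \<Rightarrow>\<^sub>0 int) set monoid" where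
  "cohomology1 V E k =
     free_Abelian_group E Mod (coboundary0 V E k ` carrier (free_Abelian_group V))"

definition primary_torsion :: "nat \<Rightarrow> ('g, 'm) monoid_scheme \<Rightarrow> 'g set" where
  "primary_torsion p G = {x \<in> carrier G. \<exists>m::nat. x [^]\<^bsub>G\<^esub> (p ^ m) = \<one>\<^bsub>G\<^esub>}"

text \<open>\<open>torsion_function V E Z\<close>: the order of the \<open>p\<close>-torsion of the first cohomology with weights
  \<open>p ^ k v\<close> is \<open>p ^ Z k\<close>. Since a prime power is positive, this includes finiteness of the torsion
  and of \<open>Z k\<close>.\<close>

definition torsion_function :: "'a set \<Rightarrow> 'a set set \<Rightarrow> (('a \<Rightarrow> nat) \<Rightarrow> tropical) \<Rightarrow> bool" where
  "torsion_function V E Z \<longleftrightarrow>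
     (\<forall>k p. prime p \<and> odd p \<longrightarrow>
        (\<exists>m::nat. Z k = Trop (int m) \<and>
           card (primary_torsion p (cohomology1 V E (\<lambda>v. p ^ k v))) = p ^ m))"

lemma simple_graph_complete: "finite V \<Longrightarrow> simple_graph V (complete_edges V)"
  by (simp add: simple_graph_def complete_edges_def)

lemma coboundary0_hom:
  assumes "simple_graph V E"
  shows "coboundary0 V E k \<in> hom (free_Abelian_group V) (free_Abelian_group E)"
proof (rule homI)
  fix x assume "x \<in> carrier (free_Abelian_group V)"
  show "coboundary0 V E k x \<in> carrier (free_Abelian_group E)"
    unfolding coboundary0_def carrier_free_Abelian_group_iff
    by (rule order_trans[OF keys_frag_extend])
       (auto dest!: subsetD[OF keys_sum] subsetD[OF keys_cmul])
qed (simp add: coboundary0_def frag_extend_add)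

lemma comm_group_cohomology1:
  assumes "simple_graph V E"
  shows "comm_group (cohomology1 V E k)"
proof -
  interpret group_hom "free_Abelian_group V" "free_Abelian_group E" "coboundary0 V E k"
    by (simp add: group_hom_def group_hom_axioms_def coboundary0_hom assms)
  show ?thesis
    unfolding cohomology1_def
    by (rule comm_group.abelian_FactGroup)
       (simp_all add: abelian_free_Abelian_group img_is_subgroup)
qed

end

theory Submission
  imports Defs
begin

text \<open>
  Order the vertices so that \<open>a\<close>, \<open>b\<close>, \<open>c\<close> carry the three least exponents, in this order, and write
  \<open>x v = p ^ k v\<close>. The Smith normal form of the coboundary can be read off from a well chosen
  family in \<open>\<int>[E]\<close>. For \<open>v \<noteq> a\<close> let \<open>g v\<close> be the coboundary of \<open>v\<close> divided by \<open>x a\<close>; this is integral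
  because \<open>x a\<close> divides all weights. Let \<open>g a\<close> be the sum of \<open>(x s x t / (x b x c)) e(s, t)\<close> over
  the edges that avoid \<open>a\<close>; it is integral because \<open>b\<close> and \<open>c\<close> have the least weights among the
  remaining vertices. Comparing coefficients gives
  \<open>d a = (\<Sum>v \<noteq> a. x v g v) - 2 D g a\<close> with \<open>D = x b x c / x a\<close> (\<open>coboundary0_min\<close>), and since
  \<open>x v g v\<close> is a multiple of \<open>d v = x a g v\<close>, the image of \<open>d\<close> is spanned by the \<open>x a g v\<close> and by
  \<open>2 D g a\<close> (\<open>coboundary0_image\<close>).

  The coefficients of the \<open>g v\<close> at the edges \<open>{a, v}\<close> and \<open>{b, c}\<close> form a unitriangular matrix,
  so the \<open>g v\<close> are a basis of a saturated sublattice (\<open>saturated_edge_basis\<close>). Therefore the torsion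
  of the cokernel is the sum of \<open>n - 1\<close> cyclic groups of order \<open>x a\<close> and one of order \<open>2 D\<close>, and
  for odd \<open>p\<close> its \<open>p\<close>-part has order \<open>p\<close> to the power
  \<open>(n - 1) k a + (k b + k c - k a) = (n - 3) k a + (k a + k b + k c)\<close>
  (\<open>card_primary_torsion_diagonal\<close>). The tropical elementary symmetric functions of degree 1 and 3 are
  \<open>k a\<close> and \<open>k a + k b + k c\<close> (\<open>elem_sym_Trop\<close>), which is the claim. Conversely the order at one
  odd prime determines the exponent, so no other function computes the torsion.
\<close>

section \<open>Torsion of a quotient of a free abelian group by a diagonal sublattice\<close>

definition int_comb :: "'i set \<Rightarrow> ('i \<Rightarrow> 'e \<Rightarrow>\<^sub>0 int) \<Rightarrow> ('i \<Rightarrow> int) \<Rightarrow> 'e \<Rightarrow>\<^sub>0 int" where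
  "int_comb J b c = (\<Sum>i\<in>J. frag_cmul (c i) (b i))"

lemma int_comb_cong: "(\<And>i. i \<in> J \<Longrightarrow> c i = c' i) \<Longrightarrow> int_comb J b c = int_comb J b c'"
  by (simp add: int_comb_def)

lemma int_comb_add: "int_comb J b (\<lambda>i. c i + c' i) = int_comb J b c + int_comb J b c'"
  by (simp add: int_comb_def frag_cmul_distrib sum.distrib)

lemma int_comb_diff: "int_comb J b (\<lambda>i. c i - c' i) = int_comb J b c - int_comb J b c'"
  by (simp add: int_comb_def frag_cmul_diff_distrib sum_subtractf)

lemma int_comb_scale: "frag_cmul m (int_comb J b c) = int_comb J b (\<lambda>i. m * c i)"
  by (simp add: int_comb_def frag_cmul_sum)

lemma keys_int_comb:
  assumes "\<And>i. i \<in> J \<Longrightarrow> Poly_Mapping.keys (b i) \<subseteq> E"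
  shows "Poly_Mapping.keys (int_comb J b c) \<subseteq> E"
  unfolding int_comb_def
  by (rule order_trans[OF keys_sum]) (use assms in auto)

text \<open>A basis of a saturated (pure) subgroup \<open>S\<close> of the free abelian group on \<open>E\<close>. Saturation makes
  the quotient by \<open>S\<close> torsion free, so that any torsion modulo a subgroup of \<open>S\<close> already lies in
  \<open>S\<close>.\<close>

definition saturated_basis :: "'e set \<Rightarrow> 'i set \<Rightarrow> ('i \<Rightarrow> 'e \<Rightarrow>\<^sub>0 int) \<Rightarrow> bool" where
  "saturated_basis E J b \<longleftrightarrow>
     finite J \<and> (\<forall>i\<in>J. Poly_Mapping.keys (b i) \<subseteq> E) \<and>
     (\<forall>c. int_comb J b c = 0 \<longrightarrow> (\<forall>i\<in>J. c i = 0)) \<and>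
     (\<forall>m y c. m \<noteq> 0 \<and> frag_cmul m y = int_comb J b c \<longrightarrow> y \<in> range (int_comb J b))"

lemma saturated_basis_coeff_unique:
  assumes "saturated_basis E J b" "int_comb J b c = int_comb J b c'" "i \<in> J"
  shows "c i = c' i"
proof -
  have "int_comb J b (\<lambda>i. c i - c' i) = 0"
    using assms(2) by (simp add: int_comb_diff)
  then show ?thesis
    using assms(1,3) unfolding saturated_basis_def by fastforce
qed

text \<open>Integral coordinate functions that are defined on the whole group, and not just on the span,
  rule out denominators: they recover from \<open>m y\<close> a combination equal to \<open>y\<close>.\<close>

lemma saturated_basis_from_coordinates:
  fixes coord :: "'i \<Rightarrow> ('e \<Rightarrow>\<^sub>0 int) \<Rightarrow> int"
  assumes "finite J" and "\<And>i. i \<in> J \<Longrightarrow> Poly_Mapping.keys (b i) \<subseteq> E"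
    and comb: "\<And>i c. i \<in> J \<Longrightarrow> coord i (int_comb J b c) = c i"
    and scale: "\<And>i m y. i \<in> J \<Longrightarrow> coord i (frag_cmul m y) = m * coord i y"
  shows "saturated_basis E J b"
proof -
  have "c i = 0" if "int_comb J b c = 0" "i \<in> J" for c i
    using comb[of i c] scale[of i 0 0] that by simp
  moreover have "y = int_comb J b (\<lambda>i. coord i y)"
    if "m \<noteq> 0" and my: "frag_cmul m y = int_comb J b c" for m y c
  proof -
    have "c i = m * coord i y" if "i \<in> J" for i
      using comb[OF that, of c] scale[OF that, of m y] my by simp
    then have "frag_cmul m y = frag_cmul m (int_comb J b (\<lambda>i. coord i y))"
      unfolding my int_comb_scale by (rule int_comb_cong)
    then show ?thesis
      using \<open>m \<noteq> 0\<close> by (metis lookup_frag_cmul mult_cancel_left poly_mapping_eqI)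
  qed
  ultimately show ?thesis
    using assms(1,2) unfolding saturated_basis_def by blast
qed

lemma free_Abelian_group_coset_eq_iff:
  assumes "subgroup I (free_Abelian_group E)"
    and "Poly_Mapping.keys x \<subseteq> E" "Poly_Mapping.keys y \<subseteq> E"
  shows "I #>\<^bsub>free_Abelian_group E\<^esub> x = I #>\<^bsub>free_Abelian_group E\<^esub> y \<longleftrightarrow> x - y \<in> I"
proof -
  interpret group "free_Abelian_group E" by simp
  have "I #>\<^bsub>free_Abelian_group E\<^esub> x = I #>\<^bsub>free_Abelian_group E\<^esub> y
      \<longleftrightarrow> x \<in> I #>\<^bsub>free_Abelian_group E\<^esub> y"
    using assms repr_independence repr_independenceD
    by (metis carrier_free_Abelian_group_iff)
  also have "\<dots> \<longleftrightarrow> x - y \<in> I"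
    using assms subgroup.rcos_module[OF assms(1) group_free_Abelian_group, of y x] by simp
  finally show ?thesis .
qed

lemma primary_torsion_free_Abelian_group_Mod:
  assumes "subgroup I (free_Abelian_group E)"
  shows "primary_torsion p (free_Abelian_group E Mod I) =
    (\<lambda>y. I #>\<^bsub>free_Abelian_group E\<^esub> y) `
      {y. Poly_Mapping.keys y \<subseteq> E \<and> (\<exists>m. frag_cmul (int (p ^ m)) y \<in> I)}"
proof -
  let ?F = "free_Abelian_group E"
  interpret normal I ?F
    by (rule comm_group.normal_iff_subgroup[OF abelian_free_Abelian_group, THEN iffD2, OF assms])
  have "(I #>\<^bsub>?F\<^esub> y) [^]\<^bsub>?F Mod I\<^esub> (p ^ m) = \<one>\<^bsub>?F Mod I\<^esub> \<longleftrightarrow> frag_cmul (int (p ^ m)) y \<in> I"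
    if "Poly_Mapping.keys y \<subseteq> E" for y and m :: nat
  proof -
    have "I #>\<^bsub>?F\<^esub> 0 = I"
      using coset_join2[of 0 I] assms subgroup.one_closed[OF assms] by simp
    then show ?thesis
      using free_Abelian_group_coset_eq_iff[OF assms, of "frag_cmul (int (p ^ m)) y" 0]
        that FactGroup_pow[of y "p ^ m"] keys_cmul[of "int (p ^ m)" y]
      by (auto simp del: of_nat_power)
  qed
  then show ?thesis
    unfolding primary_torsion_def carrier_FactGroup by (auto simp del: of_nat_power intro!: imageI)
qed

text \<open>By saturation the torsion lives in the span of the \<open>b i\<close>, where the quotient is the direct sum of
  the cyclic groups of order \<open>q i * p ^ r i\<close>. The \<open>p\<close>-torsion of the summand \<open>i\<close> consists of the
  multiples of \<open>q i\<close>, which has \<open>p ^ r i\<close> elements. The proof counts these classes by their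
  representatives \<open>h i * q i\<close> with \<open>0 \<le> h i < p ^ r i\<close>.\<close>

lemma card_primary_torsion_diagonal:
  assumes basis: "saturated_basis E J b" and p: "prime p"
    and q: "\<And>i. i \<in> J \<Longrightarrow> coprime (q i) (int p)"
    and I: "I = range (\<lambda>c. int_comb J b (\<lambda>i. c i * (q i * int p ^ r i)))"
  shows "card (primary_torsion p (free_Abelian_group E Mod I)) = p ^ (\<Sum>i\<in>J. r i)"
proof -
  let ?F = "free_Abelian_group E"
  have finJ: "finite J" and keysb: "\<And>i. i \<in> J \<Longrightarrow> Poly_Mapping.keys (b i) \<subseteq> E"
    using basis by (auto simp: saturated_basis_def)
  have keys[simp]: "Poly_Mapping.keys (int_comb J b c) \<subseteq> E" for c
    by (rule keys_int_comb) (rule keysb)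
  have p0: "0 < int p ^ e" for e
    using p by (simp add: prime_gt_0_nat)
  have q0: "q i \<noteq> 0" if "i \<in> J" for i
    using q[OF that] p by (auto simp: prime_nat_iff)
  have inI: "int_comb J b c \<in> I \<longleftrightarrow> (\<forall>i\<in>J. q i * int p ^ r i dvd c i)" for c
  proof
    assume "int_comb J b c \<in> I"
    then obtain d where d: "int_comb J b c = int_comb J b (\<lambda>i. d i * (q i * int p ^ r i))"
      by (auto simp: I)
    show "\<forall>i\<in>J. q i * int p ^ r i dvd c i"
      using saturated_basis_coeff_unique[OF basis d] by simp
  next
    assume *: "\<forall>i\<in>J. q i * int p ^ r i dvd c i"
    have "int_comb J b c = int_comb J b (\<lambda>i. c i div (q i * int p ^ r i) * (q i * int p ^ r i))"
      using * by (intro int_comb_cong) simp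
    then show "int_comb J b c \<in> I"
      unfolding I by (intro range_eqI[where x = "\<lambda>i. c i div (q i * int p ^ r i)"])
  qed
  have sub: "subgroup I ?F"
  proof (rule group.subgroupI[OF group_free_Abelian_group])
    show "I \<subseteq> carrier ?F"
      by (auto simp: I intro!: subsetD[OF keys])
    show "I \<noteq> {}"
      by (simp add: I)
    show "inv\<^bsub>?F\<^esub> y \<in> I" if "y \<in> I" for y
    proof -
      obtain c where c: "y = int_comb J b c" and "\<forall>i\<in>J. q i * int p ^ r i dvd c i"
        using \<open>y \<in> I\<close> inI unfolding I by fastforce
      then have "int_comb J b (\<lambda>i. - 1 * c i) \<in> I"
        unfolding inI by simp
      then show ?thesis
        unfolding int_comb_scale[symmetric] by (simp add: c)
    qed
    show "y \<otimes>\<^bsub>?F\<^esub> z \<in> I" if "y \<in> I" "z \<in> I" for y z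
    proof -
      obtain c d where cd: "y = int_comb J b c" "z = int_comb J b d"
        using \<open>y \<in> I\<close> \<open>z \<in> I\<close> unfolding I by blast
      with that have "int_comb J b (\<lambda>i. c i + d i) \<in> I"
        by (simp add: inI)
      then show ?thesis
        by (simp add: cd int_comb_add)
    qed
  qed
  define T where "T = {y. Poly_Mapping.keys y \<subseteq> E \<and> (\<exists>m. frag_cmul (int (p ^ m)) y \<in> I)}"
  define \<Phi> where "\<Phi> h = I #>\<^bsub>?F\<^esub> int_comb J b (\<lambda>i. h i * q i)" for h
  let ?B = "Pi\<^sub>E J (\<lambda>i. {0..<int p ^ r i})"
  have "inj_on \<Phi> ?B"
  proof (rule inj_onI)
    fix h h' assume h: "h \<in> ?B" "h' \<in> ?B" and "\<Phi> h = \<Phi> h'"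
    then have "int_comb J b (\<lambda>i. h i * q i - h' i * q i) \<in> I"
      by (simp add: \<Phi>_def free_Abelian_group_coset_eq_iff[OF sub] int_comb_diff)
    then have "int p ^ r i dvd h i - h' i" if "i \<in> J" for i
      using that q0[OF that] by (auto simp: inI mult.commute simp flip: left_diff_distrib)
    moreover have "h i \<in> {0..<int p ^ r i}" "h' i \<in> {0..<int p ^ r i}" if "i \<in> J" for i
      using h that by (auto dest: PiE_mem)
    ultimately have "h i = h' i" if "i \<in> J" for i
      using that by (metis atLeastLessThan_iff mod_eq_dvd_iff mod_pos_pos_trivial)
    then show "h = h'"
      using h by (auto intro: PiE_ext)
  qed
  moreover have "\<Phi> ` ?B = (\<lambda>y. I #>\<^bsub>?F\<^esub> y) ` T"
  proof (intro equalityI subsetI)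
    fix C assume "C \<in> \<Phi> ` ?B"
    then obtain h where C: "C = \<Phi> h" by blast
    have "int p ^ r i dvd int p ^ (\<Sum>i\<in>J. r i)" if "i \<in> J" for i
      using finJ that by (intro le_imp_power_dvd member_le_sum) auto
    then have "frag_cmul (int (p ^ (\<Sum>i\<in>J. r i))) (int_comb J b (\<lambda>i. h i * q i)) \<in> I"
      unfolding int_comb_scale inI by (auto simp: mult.commute[of "q _"] intro!: mult_dvd_mono)
    then show "C \<in> (\<lambda>y. I #>\<^bsub>?F\<^esub> y) ` T"
      unfolding C \<Phi>_def T_def by (intro imageI) auto
  next
    fix C assume "C \<in> (\<lambda>y. I #>\<^bsub>?F\<^esub> y) ` T"
    then obtain y m where C: "C = I #>\<^bsub>?F\<^esub> y" and y: "Poly_Mapping.keys y \<subseteq> E"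
      and ym: "frag_cmul (int (p ^ m)) y \<in> I"
      by (auto simp: T_def)
    have "int (p ^ m) \<noteq> 0"
      using p0[of m] by simp
    then obtain e where e: "y = int_comb J b e"
      using ym basis unfolding saturated_basis_def I by blast
    have "q i * int p ^ r i dvd int p ^ m * e i" if "i \<in> J" for i
      using ym that by (simp add: e int_comb_scale inI)
    then have qe: "q i dvd e i" if "i \<in> J" for i
      using q[OF that] that
      by (metis coprime_dvd_mult_right_iff coprime_power_right_iff dvd_mult_left)
    define h where "h i = e i div q i" for i
    have eh: "e i = h i * q i" if "i \<in> J" for i
      using qe[OF that] by (simp add: h_def)
    let ?h = "restrict (\<lambda>i. h i mod int p ^ r i) J"
    have "int_comb J b (\<lambda>i. e i - ?h i * q i) \<in> I"
      unfolding inI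
    proof
      fix i assume i: "i \<in> J"
      have "e i - ?h i * q i = q i * int p ^ r i * (h i div int p ^ r i)"
        using i by (simp add: eh minus_mod_eq_mult_div[symmetric] algebra_simps)
      then show "q i * int p ^ r i dvd e i - ?h i * q i"
        by simp
    qed
    then have "C = \<Phi> ?h"
      unfolding C \<Phi>_def e by (simp add: free_Abelian_group_coset_eq_iff[OF sub] int_comb_diff)
    then show "C \<in> \<Phi> ` ?B"
      using p0 by (intro image_eqI[of _ _ ?h]) (auto simp: PiE_iff)
  qed
  ultimately have "card (primary_torsion p (?F Mod I)) = card ?B"
    unfolding primary_torsion_free_Abelian_group_Mod[OF sub] T_def[symmetric]
    by (metis card_image)
  also have "\<dots> = p ^ (\<Sum>i\<in>J. r i)"
    using finJ by (simp add: card_PiE power_sum nat_power_eq)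
  finally show ?thesis .
qed

section \<open>The coboundary of a weighted complete graph\<close>

definition frag_on :: "'e set \<Rightarrow> ('e \<Rightarrow> int) \<Rightarrow> 'e \<Rightarrow>\<^sub>0 int" where
  "frag_on E f = (\<Sum>e\<in>E. frag_cmul (f e) (frag_of e))"

lemma lookup_frag_on:
  "finite E \<Longrightarrow> Poly_Mapping.lookup (frag_on E f) e = (if e \<in> E then f e else 0)"
  by (simp add: frag_on_def lookup_sum mult_ac if_distrib[of "times _"] cong: if_cong)

lemma keys_frag_on: "Poly_Mapping.keys (frag_on E f) \<subseteq> E"
  unfolding frag_on_def by (rule order_trans[OF keys_sum]) auto

lemma lookup_int_comb:
  "Poly_Mapping.lookup (int_comb J b c) e = (\<Sum>i\<in>J. c i * Poly_Mapping.lookup (b i) e)"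
  by (simp add: int_comb_def lookup_sum)

text \<open>Indexing the coboundary by edges instead of neighbours: the weight of the other end point of \<open>e\<close>
  is the product over \<open>e - {v}\<close>, an expression that needs no choice of that end point.\<close>

lemma coboundary0_vertex:
  assumes E: "simple_graph V E"
  shows "coboundary0 V E x (frag_of v) =
    frag_on E (\<lambda>e. if v \<in> e then \<Prod>w\<in>e - {v}. int (x w) else 0)"
proof -
  have "finite E"
    using E by (auto simp: simple_graph_def intro: finite_subset[of E "Pow V"])
  have other: "\<exists>w. w \<in> V \<and> e = {v, w} \<and> v \<noteq> w" if e: "e \<in> E" "v \<in> e" for e
  proof -
    have "card e = 2" "e \<subseteq> V"
      using E e by (auto simp: simple_graph_def)
    then show ?thesis
      using e by (auto simp: card_2_iff doubleton_eq_iff)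
  qed
  have loop: "{v, v} \<notin> E"
    using E by (auto simp: simple_graph_def)
  have "coboundary0 V E x (frag_of v)
      = (\<Sum>w | w \<in> V \<and> {v, w} \<in> E. frag_cmul (int (x w)) (frag_of {v, w}))"
    by (simp add: coboundary0_def)
  also have "\<dots> = (\<Sum>e | e \<in> E \<and> v \<in> e. frag_cmul (\<Prod>w\<in>e - {v}. int (x w)) (frag_of e))"
  proof (rule sum.reindex_bij_betw_not_neutral[where h = "\<lambda>w. {v, w}" and S' = "{}" and T' = "{}",
        simplified, THEN trans[rotated]])
    show "bij_betw (\<lambda>w. {v, w}) {w \<in> V. {v, w} \<in> E} {e \<in> E. v \<in> e}"
      using other by (auto simp: bij_betw_def inj_on_def doubleton_eq_iff image_iff)
    have "{v, w} - {v} = {w}" if "{v, w} \<in> E" for w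
      using that loop by auto
    then show "(\<Sum>w | w \<in> V \<and> {v, w} \<in> E. frag_cmul (int (x w)) (frag_of {v, w}))
        = (\<Sum>w | w \<in> V \<and> {v, w} \<in> E. frag_cmul (\<Prod>u\<in>{v, w} - {v}. int (x u)) (frag_of {v, w}))"
      by (intro sum.cong) auto
  qed
  also have "\<dots> = frag_on E (\<lambda>e. if v \<in> e then \<Prod>w\<in>e - {v}. int (x w) else 0)"
    unfolding frag_on_def using \<open>finite E\<close>
    by (intro sum.mono_neutral_cong_left) auto
  finally show ?thesis .
qed

text \<open>Weights in which \<open>a\<close>, \<open>b\<close>, \<open>c\<close> carry the three least ones with respect to divisibility, as
  happens for powers of one prime. The products of two weights away from \<open>a\<close> only have to be
  divisible by \<open>x b * x c\<close>.\<close>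

locale weighted_complete_graph =
  fixes V :: "'a set" and x :: "'a \<Rightarrow> nat" and a b c :: 'a
  assumes finite_V: "finite V"
    and abc: "a \<in> V" "b \<in> V" "c \<in> V" "a \<noteq> b" "a \<noteq> c" "b \<noteq> c"
    and pos: "x a > 0" "x b > 0" "x c > 0"
    and dvd_a: "v \<in> V \<Longrightarrow> x a dvd x v"
    and dvd_bc: "\<lbrakk>v \<in> V - {a}; w \<in> V - {a}; v \<noteq> w\<rbrakk> \<Longrightarrow> x b * x c dvd x v * x w"
begin

abbreviation "E \<equiv> complete_edges V"

text \<open>For \<open>v \<noteq> a\<close> this is the coboundary of \<open>v\<close> divided by \<open>x a\<close>. The element at \<open>a\<close> is supported off
  the star of \<open>a\<close>, with coefficient \<open>x s x t / (x b x c)\<close> at \<open>{s, t}\<close>; it absorbs what is left of the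
  coboundary of \<open>a\<close> after the other elements have been subtracted.\<close>

definition edge_basis :: "'a \<Rightarrow> 'a set \<Rightarrow>\<^sub>0 int" where
  "edge_basis v = frag_on E (\<lambda>e.
     if v = a then if a \<in> e then 0 else int ((\<Prod>w\<in>e. x w) div (x b * x c))
     else if v \<in> e then int ((\<Prod>w\<in>e - {v}. x w) div x a) else 0)"

definition invariant_factor :: "'a \<Rightarrow> nat" where
  "invariant_factor v = (if v = a then 2 * (x b * x c div x a) else x a)"

text \<open>The element at \<open>v \<noteq> a\<close> is the only one with a coefficient at \<open>{a, v}\<close>, and that coefficient
  is 1. At \<open>{b, c}\<close> the element at \<open>a\<close> has coefficient 1 too, but the elements at \<open>b\<close> and \<open>c\<close>
  also reach this edge; their contribution is known from the spokes at \<open>a\<close> and is subtracted.\<close>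

definition coordinate :: "'a \<Rightarrow> ('a set \<Rightarrow>\<^sub>0 int) \<Rightarrow> int" where
  "coordinate v y =
     (if v = a
      then Poly_Mapping.lookup y {b, c} - int (x c div x a) * Poly_Mapping.lookup y {a, b}
           - int (x b div x a) * Poly_Mapping.lookup y {a, c}
      else Poly_Mapping.lookup y {a, v})"

lemma finite_E: "finite E"
  using finite_V by (auto simp: complete_edges_def intro: finite_subset[of _ "Pow V"])

lemma edge_iff: "{s, t} \<in> E \<longleftrightarrow> s \<in> V \<and> t \<in> V \<and> s \<noteq> t"
  by (auto simp: complete_edges_def card_2_iff doubleton_eq_iff)

lemma edge_cases:
  assumes "e \<in> E"
  obtains t where "t \<in> V - {a}" "e = {a, t}"
    | s t where "s \<in> V - {a}" "t \<in> V - {a}" "s \<noteq> t" "e = {s, t}"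
proof -
  obtain s t where "e = {s, t}" "s \<noteq> t" "s \<in> V" "t \<in> V"
    using assms by (auto simp: complete_edges_def card_2_iff)
  then show thesis
    using that by (cases "s = a"; cases "t = a") (auto simp: insert_commute)
qed

lemma lookup_edge_basis_spoke:
  assumes "t \<in> V - {a}"
  shows "Poly_Mapping.lookup (edge_basis v) {a, t} = (if v = t then 1 else 0)"
proof -
  have "{a, t} - {t} = {a}"
    using assms by auto
  then show ?thesis
    using assms abc pos by (auto simp: edge_basis_def lookup_frag_on finite_E edge_iff)
qed

lemma lookup_edge_basis_rim:
  assumes "s \<in> V - {a}" "t \<in> V - {a}" "s \<noteq> t"
  shows "Poly_Mapping.lookup (edge_basis v) {s, t} =
    (if v = a then int (x s * x t div (x b * x c))
     else if v = s then int (x t div x a) else if v = t then int (x s div x a) else 0)"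
  using assms by (auto simp: edge_basis_def lookup_frag_on finite_E edge_iff insert_Diff_if)

lemma lookup_comb_spoke:
  assumes "t \<in> V - {a}"
  shows "Poly_Mapping.lookup (int_comb V edge_basis m) {a, t} = m t"
  using assms finite_V
  by (simp add: lookup_int_comb lookup_edge_basis_spoke if_distrib[of "times _"] cong: if_cong)

lemma lookup_comb_rim:
  assumes "s \<in> V - {a}" "t \<in> V - {a}" "s \<noteq> t"
  shows "Poly_Mapping.lookup (int_comb V edge_basis m) {s, t} =
    m a * int (x s * x t div (x b * x c)) + m s * int (x t div x a) + m t * int (x s div x a)"
proof -
  have "Poly_Mapping.lookup (int_comb V edge_basis m) {s, t} =
      (\<Sum>v\<in>{a, s, t}. m v * Poly_Mapping.lookup (edge_basis v) {s, t})"
    unfolding lookup_int_comb using assms abc finite_V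
    by (intro sum.mono_neutral_right) (auto simp: lookup_edge_basis_rim)
  then show ?thesis
    using assms by (auto simp: lookup_edge_basis_rim)
qed

lemma saturated_edge_basis: "saturated_basis E V edge_basis"
proof (rule saturated_basis_from_coordinates[where coord = coordinate])
  show "coordinate v (int_comb V edge_basis m) = m v" if "v \<in> V" for v m
    using that abc pos by (auto simp: coordinate_def lookup_comb_spoke lookup_comb_rim)
  show "coordinate v (frag_cmul m y) = m * coordinate v y" for v m y
    by (simp add: coordinate_def algebra_simps)
qed (simp_all add: finite_V edge_basis_def keys_frag_on)

lemma coboundary0_other:
  assumes "v \<in> V - {a}"
  shows "coboundary0 V E x (frag_of v) = frag_cmul (int (x a)) (edge_basis v)"
proof (rule poly_mapping_eqI)
  fix e
  have "int (x a) * int ((\<Prod>w\<in>e - {v}. x w) div x a) = (\<Prod>w\<in>e - {v}. int (x w))"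
    if e: "e \<in> E" "v \<in> e"
  proof -
    obtain w where "w \<in> V" "e - {v} = {w}"
      using e by (auto simp: complete_edges_def card_2_iff insert_Diff_if)
    then show ?thesis
      using dvd_a[of w] by (simp flip: of_nat_mult)
  qed
  then show "Poly_Mapping.lookup (coboundary0 V E x (frag_of v)) e =
      Poly_Mapping.lookup (frag_cmul (int (x a)) (edge_basis v)) e"
    using assms finite_E
    by (simp add: coboundary0_vertex simple_graph_complete finite_V edge_basis_def lookup_frag_on)
qed

text \<open>At \<open>{a, t}\<close> both sides are \<open>x t\<close>. At \<open>{s, t}\<close> off \<open>a\<close> the left side vanishes, while on the right
  the elements at \<open>s\<close> and \<open>t\<close> contribute \<open>x s x t / x a\<close> each. This doubling is the source of the
  factor 2 in the invariant factor at \<open>a\<close>, and of the restriction to odd primes.\<close>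

lemma coboundary0_min:
  "coboundary0 V E x (frag_of a) =
     int_comb V edge_basis (\<lambda>v. if v = a then - int (invariant_factor a) else int (x v))"
  (is "?l = ?r")
proof (rule poly_mapping_eqI)
  fix e
  have l: "Poly_Mapping.lookup ?l e = (if e \<in> E \<and> a \<in> e then \<Prod>w\<in>e - {a}. int (x w) else 0)"
    by (simp add: coboundary0_vertex simple_graph_complete finite_V lookup_frag_on finite_E)
  show "Poly_Mapping.lookup ?l e = Poly_Mapping.lookup ?r e"
  proof (cases "e \<in> E")
    case False
    then have "Poly_Mapping.lookup ?r e = 0"
      by (simp add: lookup_int_comb edge_basis_def lookup_frag_on finite_E)
    then show ?thesis
      using l False by simp
  next
    case True
    then show ?thesis
    proof (cases rule: edge_cases)
      case (1 t)
      then have "e - {a} = {t}"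
        by auto
      then show ?thesis
        using 1 l True by (simp add: lookup_comb_spoke)
    next
      case (2 s t)
      obtain xs xt where q: "x s = x a * xs" "x t = x a * xt"
        using dvd_a[of s] dvd_a[of t] 2 by (auto elim!: dvdE)
      obtain xb where "x b = x a * xb"
        using dvd_a[of b] abc by (auto elim!: dvdE)
      then obtain D where D: "x b * x c = x a * D"
        by (metis mult.assoc)
      obtain r where r: "x s * x t = (x b * x c) * r"
        using dvd_bc[of s t] 2 by (auto elim!: dvdE)
      have "x a * (D * r) = x a * (xs * xt * x a)"
        using r[symmetric] unfolding D q by (simp only: mult_ac)
      then have "D * r = xs * xt * x a"
        using pos by simp
      moreover have "x s * x t div (x b * x c) = r"
        unfolding r using pos by simp
      ultimately have "2 * (x b * x c div x a) * (x s * x t div (x b * x c))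
          = x s * (x t div x a) + x t * (x s div x a)"
        using pos unfolding D by (simp add: q mult_ac)
      then have "int (invariant_factor a) * int (x s * x t div (x b * x c))
          = int (x s) * int (x t div x a) + int (x t) * int (x s div x a)"
        unfolding invariant_factor_def by (simp only: simp_thms if_True flip: of_nat_mult of_nat_add)
      then show ?thesis
        using 2 l by (auto simp: lookup_comb_rim)
    qed
  qed
qed

lemma coboundary0_expand:
  assumes "Poly_Mapping.keys z \<subseteq> V"
  shows "coboundary0 V E x z = int_comb V edge_basis (\<lambda>v.
    (if v = a then - Poly_Mapping.lookup z a
     else Poly_Mapping.lookup z v + Poly_Mapping.lookup z a * int (x v div x a))
    * int (invariant_factor v))"
proof -
  let ?z = "Poly_Mapping.lookup z"
  have "coboundary0 V E x z = (\<Sum>v\<in>V. frag_cmul (?z v) (coboundary0 V E x (frag_of v)))"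
    unfolding coboundary0_def frag_extend_def[of _ z] frag_extend_of
    by (rule sum.mono_neutral_cong_left) (use assms finite_V in \<open>auto simp: in_keys_iff\<close>)
  also have "\<dots> = frag_cmul (?z a) (coboundary0 V E x (frag_of a))
      + (\<Sum>v\<in>V - {a}. frag_cmul (?z v) (coboundary0 V E x (frag_of v)))"
    using abc finite_V by (simp add: sum.remove)
  also have "(\<Sum>v\<in>V - {a}. frag_cmul (?z v) (coboundary0 V E x (frag_of v)))
      = int_comb V edge_basis (\<lambda>v. if v = a then 0 else ?z v * int (x a))"
    unfolding int_comb_def using finite_V
    by (intro sum.mono_neutral_cong_left) (auto simp: coboundary0_other)
  also have "frag_cmul (?z a) (coboundary0 V E x (frag_of a)) + \<dots> = int_comb V edge_basis (\<lambda>v.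
      ?z a * (if v = a then - int (invariant_factor a) else int (x v))
      + (if v = a then 0 else ?z v * int (x a)))"
    by (simp only: coboundary0_min int_comb_scale int_comb_add)
  also have "\<dots> = int_comb V edge_basis (\<lambda>v.
      (if v = a then - ?z a else ?z v + ?z a * int (x v div x a)) * int (invariant_factor v))"
  proof (rule int_comb_cong)
    fix v assume "v \<in> V"
    then obtain t where "x v = x a * t"
      using dvd_a by (auto elim!: dvdE)
    then show "?z a * (if v = a then - int (invariant_factor a) else int (x v))
        + (if v = a then 0 else ?z v * int (x a)) =
      (if v = a then - ?z a else ?z v + ?z a * int (x v div x a)) * int (invariant_factor v)"
      using pos by (simp add: invariant_factor_def algebra_simps)
  qed
  finally show ?thesis .
qed

text \<open>As \<open>x a\<close> divides every weight, the terms \<open>x v\<close> in the coboundary of \<open>a\<close> can be cleared with the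
  coboundaries of the other vertices. Hence the image is exactly the diagonal sublattice of the
  invariant factors.\<close>

lemma coboundary0_image:
  "coboundary0 V E x ` carrier (free_Abelian_group V) =
     range (\<lambda>m. int_comb V edge_basis (\<lambda>v. m v * int (invariant_factor v)))"
proof (intro equalityI subsetI)
  fix y assume "y \<in> range (\<lambda>m. int_comb V edge_basis (\<lambda>v. m v * int (invariant_factor v)))"
  then obtain m where y: "y = int_comb V edge_basis (\<lambda>v. m v * int (invariant_factor v))"
    by blast
  \<comment> \<open>the substitution in \<open>coboundary0_expand\<close>, inverted\<close>
  define z where "z = frag_on V (\<lambda>v. if v = a then - m a else m v + m a * int (x v div x a))"
  have z: "Poly_Mapping.keys z \<subseteq> V"
    by (simp add: z_def keys_frag_on)
  have "coboundary0 V E x z = y"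
    unfolding coboundary0_expand[OF z] y using abc
    by (intro int_comb_cong) (auto simp: z_def lookup_frag_on finite_V)
  with z show "y \<in> coboundary0 V E x ` carrier (free_Abelian_group V)"
    by auto
qed (auto simp: coboundary0_expand)

end

section \<open>Counting the torsion for prime power weights\<close>

lemma card_primary_torsion_complete_graph:
  fixes V :: "'a set" and k :: "'a \<Rightarrow> nat"
  assumes "finite V" and abc: "a \<in> V" "b \<in> V" "c \<in> V" "a \<noteq> b" "a \<noteq> c" "b \<noteq> c"
    and le: "k a \<le> k b" "k b \<le> k c" "\<And>v. v \<in> V - {a, b, c} \<Longrightarrow> k c \<le> k v"
    and p: "prime p" "odd p"
  shows "card (primary_torsion p (cohomology1 V (complete_edges V) (\<lambda>v. p ^ k v))) =
    p ^ ((card V - 3) * k a + (k a + k b + k c))"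
proof -
  have "k b + k c \<le> k v + k w" if "v \<in> V - {a}" "w \<in> V - {a}" "v \<noteq> w" for v w
    using that le(1,2) le(3)[of v] le(3)[of w] by (cases "v \<in> {b, c}"; cases "w \<in> {b, c}") auto
  moreover have "k a \<le> k v" if "v \<in> V" for v
    using that le(1,2) le(3)[of v] by (cases "v \<in> {a, b, c}") auto
  ultimately interpret weighted_complete_graph V "\<lambda>v. p ^ k v" a b c
    using assms prime_gt_0_nat[OF p(1)]
    by unfold_locales (auto simp: le_imp_power_dvd simp flip: power_add)
  \<comment> \<open>\<open>q v\<close> is the part of the invariant factor prime to \<open>p\<close>, \<open>r v\<close> the exponent of its \<open>p\<close>-part\<close>
  define r where "r v = (if v = a then k b + k c - k a else k a)" for v
  define q where "q v = (if v = a then 2 else 1 :: int)" for v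
  have "p ^ k b * p ^ k c div p ^ k a = p ^ (k b + k c - k a)"
    using power_diff[of p "k a" "k b + k c"] le p by (auto simp: power_add)
  then have factor: "int (invariant_factor v) = q v * int p ^ r v" for v
    by (simp add: invariant_factor_def q_def r_def)
  have "card (primary_torsion p (cohomology1 V E (\<lambda>v. p ^ k v))) = p ^ (\<Sum>v\<in>V. r v)"
    unfolding cohomology1_def
  proof (rule card_primary_torsion_diagonal[OF saturated_edge_basis p(1)])
    show "coprime (q v) (int p)" for v
      using p by (simp add: q_def)
  qed (simp add: coboundary0_image factor)
  also have "(\<Sum>v\<in>V. r v) = r a + (card V - 1) * k a"
    using abc \<open>finite V\<close> by (subst sum.remove[of _ a]) (auto simp: r_def)
  also have "\<dots> = (card V - 3) * k a + (k a + k b + k c)"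
  proof -
    have "card {a, b, c} \<le> card V"
      using abc \<open>finite V\<close> by (intro card_mono) auto
    then obtain n where "card V = n + 3"
      using abc le_Suc_ex[of 3 "card V"] by (auto simp: add.commute)
    then show ?thesis
      using le by (simp add: r_def)
  qed
  finally show ?thesis .
qed

section \<open>Tropical elementary symmetric functions\<close>

lemma Trop_power: "Trop i ^ m = Trop (int m * i)"
  by (induction m) (auto simp: one_tropical_def algebra_simps)

lemma prod_Trop: "finite X \<Longrightarrow> (\<Prod>v\<in>X. Trop (f v)) = Trop (\<Sum>v\<in>X. f v)"
  by (induction X rule: finite_induct) (auto simp: one_tropical_def)

lemma sum_Trop_eq_least:
  assumes "finite S" "s \<in> S" "\<And>t. t \<in> S \<Longrightarrow> f s \<le> f t"
  shows "(\<Sum>t\<in>S. Trop (f t)) = Trop (f s)"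
proof -
  have "Trop (f s) + (\<Sum>t\<in>T. Trop (f t)) = Trop (f s)" if "T \<subseteq> S" for T
    using finite_subset[OF that assms(1)] that
  proof (induction T rule: finite_induct)
    case empty
    then show ?case by simp
  next
    case (insert t T)
    have "Trop (f s) + Trop (f t) = Trop (f s)"
      using assms(3)[of t] insert.prems by simp
    then show ?case
      using insert by (simp add: add.assoc[symmetric])
  qed
  from this[of "S - {s}"] show ?thesis
    using assms(1,2) by (simp add: sum.remove)
qed

text \<open>Among the subsets of a given size, one made of least elements has the least sum: any competitor
  \<open>X\<close> exchanges \<open>Y - X\<close> for equally many elements outside \<open>Y\<close>, none of which is smaller.\<close>

lemma elem_sym_Trop:
  assumes "finite V" "Y \<subseteq> V" and least: "\<And>y v. \<lbrakk>y \<in> Y; v \<in> V - Y\<rbrakk> \<Longrightarrow> f y \<le> f v"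
  shows "elem_sym (card Y) V (\<lambda>v. Trop (f v)) = Trop (\<Sum>v\<in>Y. f v)"
proof -
  have fin: "finite X" if "X \<subseteq> V" for X
    using that assms(1) by (rule finite_subset)
  have "sum f Y \<le> sum f X" if X: "X \<subseteq> V" "card X = card Y" for X
  proof -
    have "card (Y - X) = card (X - Y)"
      using X fin assms(2) by (metis card_Diff_subset_Int Int_commute finite_Int)
    then obtain h where h: "bij_betw h (Y - X) (X - Y)"
      using fin X assms(2) by (metis finite_Diff finite_same_card_bij)
    have "sum f (Y - X) \<le> (\<Sum>v\<in>Y - X. f (h v))"
      using X bij_betwE[OF h] by (intro sum_mono least) auto
    also have "\<dots> = sum f (X - Y)"
      by (rule sum.reindex_bij_betw[OF h])
    finally show ?thesis
      using sum.Int_Diff[OF fin[OF assms(2)], of f X] sum.Int_Diff[OF fin[OF X(1)], of f Y]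
      by (simp add: Int_commute)
  qed
  moreover have "elem_sym (card Y) V (\<lambda>v. Trop (f v)) =
      (\<Sum>X | X \<subseteq> V \<and> card X = card Y. Trop (sum f X))"
    unfolding elem_sym_def by (intro sum.cong) (auto simp: prod_Trop fin)
  ultimately show ?thesis
    using assms(1,2) sum_Trop_eq_least[of "{X. X \<subseteq> V \<and> card X = card Y}" Y "sum f"] by simp
qed

lemma three_least_elements:
  fixes k :: "'a \<Rightarrow> nat"
  assumes "finite V" "card V \<ge> 3"
  obtains a b c where "a \<in> V" "b \<in> V" "c \<in> V" "a \<noteq> b" "a \<noteq> c" "b \<noteq> c"
    "k a \<le> k b" "k b \<le> k c" "\<And>v. v \<in> V - {a, b, c} \<Longrightarrow> k c \<le> k v"
proof -
  have least: "\<exists>s\<in>S. \<forall>t\<in>S. k s \<le> k t" if "S \<noteq> {}" for S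
    using that ex_has_least_nat[of "\<lambda>s. s \<in> S" _ k] by (metis ex_in_conv)
  have rest: "V - X \<noteq> {}" if "finite X" "card X < 3" for X
    using that assms by (metis Diff_eq_empty_iff card_mono leD le_trans)
  obtain a where a: "a \<in> V" "\<forall>t\<in>V. k a \<le> k t"
    using least[OF rest[of "{}"]] by auto
  obtain b where b: "b \<in> V - {a}" "\<forall>t\<in>V - {a}. k b \<le> k t"
    using least[OF rest[of "{a}"]] by auto
  obtain c where c: "c \<in> V - {a, b}" "\<forall>t\<in>V - {a, b}. k c \<le> k t"
    using least[OF rest[of "{a, b}"]] b by (force simp: card_insert_if)
  show thesis
    using a b c by (intro that[of a b c]) auto
qed

section \<open>The torsion function of a complete graph\<close>

theorem theorem67:
  fixes V :: "'a set" and n :: nat and Z :: "('a \<Rightarrow> nat) \<Rightarrow> tropical"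
  assumes "n \<ge> 3" and "finite V" and "card V = n"
  shows "torsion_function V (complete_edges V) Z \<longleftrightarrow>
    (\<forall>k. Z k = elem_sym 1 V (\<lambda>v. Trop (int (k v))) ^ (n - 3) *
               elem_sym 3 V (\<lambda>v. Trop (int (k v))))"
proof -
  define R where "R k = elem_sym 1 V (\<lambda>v. Trop (int (k v))) ^ (n - 3) *
    elem_sym 3 V (\<lambda>v. Trop (int (k v)))" for k
  have key: "\<exists>M::nat. R k = Trop (int M) \<and> (\<forall>p. prime p \<and> odd p \<longrightarrow>
      card (primary_torsion p (cohomology1 V (complete_edges V) (\<lambda>v. p ^ k v))) = p ^ M)" for k
  proof -
    obtain a b c where abc: "a \<in> V" "b \<in> V" "c \<in> V" "a \<noteq> b" "a \<noteq> c" "b \<noteq> c"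
      and le: "k a \<le> k b" "k b \<le> k c" "\<And>v. v \<in> V - {a, b, c} \<Longrightarrow> k c \<le> k v"
      using three_least_elements[of V k] assms by metis
    have "k a \<le> k v" if "v \<in> V" for v
      using that le(1,2) le(3)[of v] by (cases "v \<in> {a, b, c}") auto
    then have "elem_sym 1 V (\<lambda>v. Trop (int (k v))) = Trop (int (k a))"
      using elem_sym_Trop[of V "{a}" "\<lambda>v. int (k v)"] abc assms(2) by simp
    moreover have "int (k y) \<le> int (k v)" if "y \<in> {a, b, c}" "v \<in> V - {a, b, c}" for y v
      using that le(1,2) le(3)[of v] by auto
    then have "elem_sym 3 V (\<lambda>v. Trop (int (k v))) = Trop (int (k a + k b + k c))"
      using elem_sym_Trop[of V "{a, b, c}" "\<lambda>v. int (k v)"] abc assms(2)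
      by (simp add: numeral_3_eq_3)
    ultimately have "R k = Trop (int ((n - 3) * k a + (k a + k b + k c)))"
      unfolding R_def by (simp add: Trop_power)
    then show ?thesis
      using card_primary_torsion_complete_graph[OF assms(2) abc le] assms(3) by blast
  qed
  have prime_3: "prime (3::nat)"
    by simp
  have "torsion_function V (complete_edges V) Z \<longleftrightarrow> (\<forall>k. Z k = R k)"
  proof
    assume Z: "torsion_function V (complete_edges V) Z"
    show "\<forall>k. Z k = R k"
    proof
      fix k
      \<comment> \<open>a single odd prime, here 3, already determines the exponent\<close>
      obtain m where "Z k = Trop (int m)"
        and "card (primary_torsion 3 (cohomology1 V (complete_edges V) (\<lambda>v. 3 ^ k v))) = 3 ^ m"
        using Z unfolding torsion_function_def by (metis odd_numeral prime_3)
      moreover obtain M where "R k = Trop (int M)"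
        and "card (primary_torsion 3 (cohomology1 V (complete_edges V) (\<lambda>v. 3 ^ k v))) = 3 ^ M"
        using key[of k] prime_3 by auto
      ultimately show "Z k = R k"
        by simp
    qed
  next
    assume "\<forall>k. Z k = R k"
    then show "torsion_function V (complete_edges V) Z"
      unfolding torsion_function_def using key by metis
  qed
  then show ?thesis
    by (simp only: R_def)
qed

end
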